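(* Let $n \in \mathbb{N}$ and let $\mathcal{S}$ be an irreducible semigroup of triangularizable matrices in $M_n(\mathbb{R})$. Then $\mathrm{Alg}_{\mathbb{R}}(\mathcal{S}) = M_n(\mathbb{R})$.
   Context: A semigroup of matrices is a set of matrices closed under matrix multiplication. A semigroup $\mathcal{S} \subseteq M_n(\mathbb{R})$ is irreducible if for every nonzero $x \in \mathbb{R}^n$ the orbit $\{Sx : S \in \mathcal{S}\}$ spans $\mathbb{R}^n$ (for $n>1$: the members of $\mathcal{S}$ have no common invariant subspace other than $\{0\}$ and $\mathbb{R}^n$). "Semigroup of triangularizable matrices" means that each individual member is triangularizable: $A \in M_n(\mathbb{R})$ is triangularizable if $P^{-1}AP$ is upper triangular for some invertible $P \in M_n(\mathbb{R})$ (with $P$ allowed to depend on $A$). $\mathrm{Alg}_{\mathbb{R}}(\mathcal{S})$ is the $\mathbb{R}$-algebra generated by $\mathcal{S}$, which equals the $\mathbb{R}$-linear span of $\mathcal{S}$. *)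

theory Defs
  imports "HOL-Analysis.Analysis"
begin

definition matrix_semigroup :: "(real ^ 'n ^ 'n) set \<Rightarrow> bool" where
  "matrix_semigroup S \<longleftrightarrow> (\<forall>A\<in>S. \<forall>B\<in>S. A ** B \<in> S)"

definition irreducible_matrices :: "(real ^ 'n ^ 'n) set \<Rightarrow> bool" where
  "irreducible_matrices S \<longleftrightarrow> (\<forall>x. x \<noteq> 0 \<longrightarrow> span {A *v x | A. A \<in> S} = UNIV)"

(* Triangularity refers to an ordering of the row/column indices, hence the sort
   constraint: a finite linearly ordered type is a copy of {1, ..., CARD('n)}.
   In "A $ i $ j" the index i is the row and j the column. *)
definition upper_triangular_matrix :: "real ^ 'n::{finite, linorder} ^ 'n::{finite, linorder} \<Rightarrow> bool"
  where
  "upper_triangular_matrix A \<longleftrightarrow> (\<forall>i j. j < i \<longrightarrow> A $ i $ j = 0)"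

definition triangularizable :: "real ^ 'n::{finite, linorder} ^ 'n::{finite, linorder} \<Rightarrow> bool"
  where
  "triangularizable A \<longleftrightarrow>
     (\<exists>P :: real ^ 'n::{finite, linorder} ^ 'n::{finite, linorder}.
        invertible P \<and> upper_triangular_matrix (matrix_inv P ** A ** P))"

(* The product is "**"; the type-class product "*" on real ^ 'n ^ 'n is componentwise.
   Subalgebras are not required to contain the identity matrix. *)
definition matrix_subalgebra :: "(real ^ 'n ^ 'n) set \<Rightarrow> bool" where
  "matrix_subalgebra T \<longleftrightarrow> subspace T \<and> (\<forall>A\<in>T. \<forall>B\<in>T. A ** B \<in> T)"

definition matrix_Alg :: "(real ^ 'n ^ 'n) set \<Rightarrow> (real ^ 'n ^ 'n) set" where
  "matrix_Alg S = matrix_subalgebra hull S"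

lemma span_matrix_mult_closed:
  fixes S :: "(real ^ 'n ^ 'n) set"
  assumes "matrix_semigroup S" "A \<in> span S" "B \<in> span S"
  shows "A ** B \<in> span S"
proof -
  have l: "linear (\<lambda>A. A ** B)" for B :: "real ^ 'n ^ 'n"
    by (rule linearI) (simp_all add: vec_eq_iff matrix_matrix_mult_def sum.distrib sum_distrib_left algebra_simps)
  have r: "linear (\<lambda>B. A ** B)" for A :: "real ^ 'n ^ 'n"
    by (rule linearI) (simp_all add: matrix_add_ldistrib matrix_scalar_ac scalar_matrix_assoc)
  have *: "A ** C \<in> span S" if "A \<in> S" "C \<in> span S" for A C
  proof -
    have "A ** C \<in> span ((\<lambda>B. A ** B) ` S)"
      using that(2) unfolding linear_span_image [OF r] by (rule imageI)
    also have "\<dots> \<subseteq> span S"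
      using \<open>A \<in> S\<close> assms(1) by (intro span_mono) (auto simp: matrix_semigroup_def)
    finally show ?thesis .
  qed
  have "A ** B \<in> span ((\<lambda>A. A ** B) ` S)"
    using assms(2) unfolding linear_span_image [OF l] by (rule imageI)
  also have "\<dots> \<subseteq> span S"
    using *[OF _ assms(3)] by (intro span_minimal) (auto intro: subspace_span)
  finally show ?thesis .
qed

lemma matrix_Alg_eq_span:
  assumes "matrix_semigroup S"
  shows "matrix_Alg S = span S"
  unfolding matrix_Alg_def
proof (rule hull_unique)
  show "S \<subseteq> span S" by (rule span_superset)
  show "matrix_subalgebra (span S)"
    unfolding matrix_subalgebra_def using span_matrix_mult_closed [OF assms] subspace_span by blast
  show "span S \<subseteq> T" if "S \<subseteq> T" "matrix_subalgebra T" for T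
    using that unfolding matrix_subalgebra_def by (intro span_minimal) simp_all
qed

end

theory Submission
  imports Defs
begin

text \<open>
  The key is a matrix of rank one in the span of \<open>S\<close>. From it the whole matrix space is
  reached by moving its column factor with \<open>S\<close> and its row factor with the transposes of \<open>S\<close>,
  both of which act irreducibly (\<open>irreducible_rank_one_span\<close>).

  The span alone does not suffice to find it: its elements can have non-real eigenvalues, and
  irreducible real algebras such as the complex numbers or the quaternions contain no element of
  real rank one. So the argument stays with the semigroup and enlarges it to
  \<open>K = closure {c *\<^sub>R A | c A. A \<in> S}\<close>, which lies in the span, is again a
  multiplicative semigroup, and still has only matrices with real spectrum, because the property of
  being annihilated by a product of \<open>n\<close> real linear factors survives limits (\<open>real_split_limit\<close>).

  Consider a nonzero element of \<open>K\<close> whose kernel is maximal among the kernels of such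
  elements. If such an element \<open>C\<close> fixes a nonzero vector, its powers are bounded: otherwise a
  limit of normalised powers would be a nonzero element of \<open>K\<close> with a strictly larger kernel
  (\<open>minimal_powers_bounded\<close>). A matrix with bounded powers and real eigenvalues has no Jordan
  growth, and applying the same bound to rescaled copies of \<open>C\<close> forces every nonzero eigenvalue to
  be \<open>\<plusminus>1\<close>. Hence \<open>C\<^sup>3 = C\<close> (\<open>minimal_cube\<close>), and rescaling yields an idempotent \<open>e\<close> in \<open>K\<close>
  with maximal kernel.

  In the corner \<open>e K e\<close> every nonzero element therefore squares to a positive multiple of \<open>e\<close>, as in
  a group of involutions, and so the corner is commutative (\<open>corner_commute\<close>). By irreducibility an
  eigenspace of one corner element is all of the range of \<open>e\<close>, so the corner consists of multiples
  of \<open>e\<close> (\<open>corner_scalar\<close>). But the corner also acts irreducibly on the range of \<open>e\<close>, which must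
  then be a line (\<open>ex_rank_one\<close>).
\<close>

section \<open>Real spectrum as a closed condition\<close>

lemma tendsto_matrix_vector_mult:
  fixes A :: "'b \<Rightarrow> real ^ 'n ^ 'm"
  assumes "(A \<longlongrightarrow> B) F" "(x \<longlongrightarrow> y) F"
  shows "((\<lambda>k. A k *v x k) \<longlongrightarrow> B *v y) F"
  unfolding matrix_vector_mult_def
  by (intro tendsto_vec_lambda tendsto_sum tendsto_mult tendsto_vec_nth assms)

lemma tendsto_matrix_matrix_mult:
  fixes A :: "'b \<Rightarrow> real ^ 'n ^ 'm"
  assumes "(A \<longlongrightarrow> A') F" "(B \<longlongrightarrow> B') F"
  shows "((\<lambda>k. A k ** B k) \<longlongrightarrow> A' ** B') F"
  unfolding matrix_matrix_mult_def
  by (intro tendsto_vec_lambda tendsto_sum tendsto_mult tendsto_vec_nth assms)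

text \<open>
  The linear factors are homogeneous: unlike the roots \<open>b\<^sub>i / a\<^sub>i\<close>, the coefficients can be
  normalised so as to stay bounded.
\<close>

definition apply_factors ::
  "real ^ 'n ^ 'n \<Rightarrow> real ^ 'n \<Rightarrow> real ^ 'n \<Rightarrow> 'n list \<Rightarrow> real ^ 'n \<Rightarrow> real ^ 'n"
  where "apply_factors A a b xs v = foldr (\<lambda>i w. a $ i *\<^sub>R (A *v w) - b $ i *\<^sub>R w) xs v"

lemma apply_factors_simps [simp]:
  "apply_factors A a b [] v = v"
  "apply_factors A a b (i # xs) v =
     a $ i *\<^sub>R (A *v apply_factors A a b xs v) - b $ i *\<^sub>R apply_factors A a b xs v"
  "apply_factors A a b (xs @ [i]) v = apply_factors A a b xs (a $ i *\<^sub>R (A *v v) - b $ i *\<^sub>R v)"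
  by (simp_all add: apply_factors_def)

text \<open>
  This expresses that all complex eigenvalues are real. The normalisation puts each pair
  \<open>(a\<^sub>i, b\<^sub>i)\<close> on the unit circle. The coefficients thus range over a compact set that does not
  depend on \<open>A\<close>, and this is what makes the condition closed.
\<close>

definition real_split :: "real ^ 'n::{finite, linorder} ^ 'n::{finite, linorder} \<Rightarrow> bool" where
  "real_split A \<longleftrightarrow> (\<exists>a b. (\<forall>i. (a $ i)\<^sup>2 + (b $ i)\<^sup>2 = 1) \<and>
     (\<forall>v. apply_factors A a b (sorted_list_of_set UNIV) v = 0))"

text \<open>
  The vectors supported on an initial segment of the indices form a flag that an upper triangular
  matrix preserves, and subtracting the diagonal entry \<open>U\<^sub>k\<^sub>k\<close> pushes each member of the flag into
  the previous one.
\<close>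

lemma upper_triangular_annihilated:
  fixes U :: "real ^ 'n::{finite, linorder} ^ 'n::{finite, linorder}"
  assumes U: "upper_triangular_matrix U"
    and "sorted xs" "distinct xs" "\<And>i j. j \<in> set xs \<Longrightarrow> i \<le> j \<Longrightarrow> i \<in> set xs"
    and "\<And>i. i \<notin> set xs \<Longrightarrow> v $ i = 0"
  shows "apply_factors U (\<chi> i. 1) (\<chi> i. U $ i $ i) xs v = 0"
  using assms(2-)
proof (induction xs arbitrary: v rule: rev_induct)
  case Nil
  then show ?case by (simp add: vec_eq_iff)
next
  case (snoc k xs)
  let ?w = "U *v v - U $ k $ k *\<^sub>R v"
  have less: "i < k" if "i \<in> set xs" for i
    using snoc.prems(1,2) that by (auto simp: sorted_append order.strict_iff_order)
  have down: "i \<in> set xs" if "j \<in> set xs" "i \<le> j" for i j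
    using snoc.prems(3)[of j i] less[OF that(1)] that by auto
  have "?w $ i = 0" if i: "i \<notin> set xs" for i
  proof -
    have ki: "k \<le> i"
      using snoc.prems(3)[of k i] i by (cases "i \<le> k") auto
    have entry: "U $ i $ j * v $ j = (if j = k then U $ i $ k * v $ k else 0)" for j
    proof (cases "j \<in> set xs")
      case True
      then have "j < i" using less ki by (meson order.strict_trans2)
      then show ?thesis using U True less[OF True] by (auto simp: upper_triangular_matrix_def)
    next
      case False
      then show ?thesis using snoc.prems(4)[of j] by auto
    qed
    have "(U *v v) $ i = (\<Sum>j\<in>UNIV. if j = k then U $ i $ k * v $ k else 0)"
      unfolding matrix_vector_mult_def by (simp only: vec_lambda_beta) (intro sum.cong refl entry)
    also have "\<dots> = U $ i $ k * v $ k" by simp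
    finally have "(U *v v) $ i = U $ i $ k * v $ k" .
    moreover have "U $ i $ k = 0" if "i \<noteq> k"
    proof -
      have "k < i" using that ki by simp
      then show ?thesis using U by (simp add: upper_triangular_matrix_def)
    qed
    moreover have "v $ i = 0" if "i \<noteq> k"
      using that i by (intro snoc.prems(4)) simp
    ultimately show ?thesis by (cases "i = k") auto
  qed
  then have "apply_factors U (\<chi> i. 1) (\<chi> i. U $ i $ i) xs ?w = 0"
    using snoc.prems(1,2) down by (intro snoc.IH) (auto simp: sorted_append)
  then show ?case by simp
qed

lemma apply_factors_intertwine:
  assumes "A ** P = P ** U"
  shows "apply_factors A a b xs (P *v v) = P *v apply_factors U a b xs v"
proof (induction xs)
  case (Cons i xs)
  have "A *v (P *v w) = P *v (U *v w)" for w
    by (metis assms matrix_vector_mul_assoc)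
  with Cons show ?case
    by (simp add: matrix_vector_mult_diff_distrib matrix_vector_mult_scaleR)
qed simp

lemma apply_factors_scale:
  assumes "\<And>i. a' $ i *\<^sub>R A' = (s i * a $ i) *\<^sub>R A" "\<And>i. b' $ i = s i * b $ i"
  shows "\<exists>t. apply_factors A' a' b' xs v = t *\<^sub>R apply_factors A a b xs v"
proof (induction xs)
  case Nil
  show ?case by (rule exI[of _ 1]) simp
next
  case (Cons i xs)
  then obtain t where t: "apply_factors A' a' b' xs v = t *\<^sub>R apply_factors A a b xs v" by blast
  let ?w = "apply_factors A a b xs v"
  have "a' $ i *\<^sub>R (A' *v ?w) = (s i * a $ i) *\<^sub>R (A *v ?w)"
    by (metis assms(1) scaleR_matrix_vector_assoc)
  then have "t *\<^sub>R (a' $ i *\<^sub>R (A' *v ?w)) = t *\<^sub>R ((s i * a $ i) *\<^sub>R (A *v ?w))"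
    by simp
  then show ?case
    by (intro exI[of _ "s i * t"])
      (simp add: t assms(2) matrix_vector_mult_scaleR scaleR_diff_right ac_simps)
qed

lemma real_split_scaleR_triangularizable:
  fixes A :: "real ^ 'n::{finite, linorder} ^ 'n::{finite, linorder}"
  assumes "triangularizable A"
  shows "real_split (c *\<^sub>R A)"
proof -
  obtain P :: "((real, 'n) vec, 'n) vec" where P: "invertible P" and U: "upper_triangular_matrix (matrix_inv P ** A ** P)"
    using assms unfolding triangularizable_def by blast
  define U where "U = matrix_inv P ** A ** P"
  have PP: "P ** matrix_inv P = mat 1"
    using P unfolding invertible_def matrix_inv_def by (rule someI2_ex) simp
  have PU: "A ** P = P ** U"
    using PP by (simp add: U_def matrix_mul_assoc)
  have zero: "apply_factors A (\<chi> i. 1) (\<chi> i. U $ i $ i) (sorted_list_of_set UNIV) v = 0" for v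
  proof -
    have "apply_factors U (\<chi> i. 1) (\<chi> i. U $ i $ i) (sorted_list_of_set UNIV) (matrix_inv P *v v) = 0"
      using U by (intro upper_triangular_annihilated) (auto simp: U_def)
    then have "apply_factors A (\<chi> i. 1) (\<chi> i. U $ i $ i) (sorted_list_of_set UNIV)
        (P *v (matrix_inv P *v v)) = 0"
      by (simp add: apply_factors_intertwine[OF PU])
    then show ?thesis
      using PP by (simp add: matrix_vector_mul_assoc)
  qed
  \<comment> \<open>Divide each factor by the length of its coefficient pair \<open>(1, c U\<^sub>i\<^sub>i)\<close>.\<close>
  define r where "r i = sqrt (1 + (c * U $ i $ i)\<^sup>2)" for i
  have r: "r i > 0" "(r i)\<^sup>2 = 1 + (c * U $ i $ i)\<^sup>2" for i
  proof -
    have "1 + (c * U $ i $ i)\<^sup>2 > 0" by (intro add_pos_nonneg) auto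
    then show "r i > 0" "(r i)\<^sup>2 = 1 + (c * U $ i $ i)\<^sup>2" by (simp_all add: r_def)
  qed
  define a b :: "(real, 'n) vec" where "a = (\<chi> i. 1 / r i)" and "b = (\<chi> i. c * U $ i $ i / r i)"
  have "(a $ i)\<^sup>2 + (b $ i)\<^sup>2 = 1" for i
  proof -
    have "(a $ i)\<^sup>2 + (b $ i)\<^sup>2 = (1 + (c * U $ i $ i)\<^sup>2) / (r i)\<^sup>2"
      by (simp add: a_def b_def power_divide add_divide_distrib)
    then show ?thesis using r(1)[of i] by (simp flip: r(2))
  qed
  moreover have "apply_factors (c *\<^sub>R A) a b (sorted_list_of_set UNIV) v = 0" for v
    using apply_factors_scale[of a "c *\<^sub>R A" "\<lambda>i. c / r i" "\<chi> i. 1" A b "\<chi> i. U $ i $ i"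
        "sorted_list_of_set UNIV" v] zero[of v]
    by (auto simp: a_def b_def)
  ultimately show ?thesis unfolding real_split_def by blast
qed

lemma tendsto_apply_factors:
  assumes "(A \<longlongrightarrow> A') F" "(a \<longlongrightarrow> a') F" "(b \<longlongrightarrow> b') F"
  shows "((\<lambda>k. apply_factors (A k) (a k) (b k) xs v) \<longlongrightarrow> apply_factors A' a' b' xs v) F"
  by (induction xs) (auto intro!: tendsto_intros tendsto_matrix_vector_mult assms)

text \<open>
  The coefficient vectors stay on a product of unit circles, so a subsequence of them converges, and
  the annihilating product is continuous in the matrix and the coefficients together.
\<close>

lemma real_split_limit:
  fixes A :: "nat \<Rightarrow> real ^ 'n::{finite, linorder} ^ 'n::{finite, linorder}"
  assumes split: "\<And>k. real_split (A k)" and lim: "A \<longlonglongrightarrow> A'"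
  shows "real_split A'"
proof -
  let ?xs = "sorted_list_of_set UNIV"
  obtain a b where ab: "\<And>k i. (a k $ i)\<^sup>2 + (b k $ i)\<^sup>2 = 1"
    and zero: "\<And>k v. apply_factors (A k) (a k) (b k) ?xs v = 0"
    using split unfolding real_split_def by metis
  have le1: "\<bar>x\<bar> \<le> 1" if "x\<^sup>2 + y\<^sup>2 = 1" for x y :: real
    using that by (metis abs_le_square_iff abs_one le_add_same_cancel1 one_power2 zero_le_power2)
  have le: "\<bar>a k $ i\<bar> \<le> 1" "\<bar>b k $ i\<bar> \<le> 1" for k i
    using le1[OF ab] ab[of k i] le1[of "b k $ i" "a k $ i"] by (auto simp: add.commute)
  have norm_le: "norm x \<le> real CARD('n)" if "\<And>i. \<bar>x $ i\<bar> \<le> 1" for x :: "(real, 'n) vec"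
    using norm_le_l1_cart[of x] sum_mono[of UNIV "\<lambda>i. \<bar>x $ i\<bar>" "\<lambda>_. 1"] that by auto
  have "norm (a k, b k) \<le> real CARD('n) + real CARD('n)" for k
    using norm_Pair_le[of "a k" "b k"] norm_le[of "a k"] norm_le[of "b k"] le by fastforce
  then have "bounded (range (\<lambda>k. (a k, b k)))"
    unfolding bounded_iff by blast
  then obtain l r where r: "strict_mono r" and l: "((\<lambda>k. (a k, b k)) \<circ> r) \<longlonglongrightarrow> l"
    by (metis bounded_imp_convergent_subsequence)
  have la: "(\<lambda>k. a (r k)) \<longlonglongrightarrow> fst l" and lb: "(\<lambda>k. b (r k)) \<longlonglongrightarrow> snd l"
    using tendsto_fst[OF l] tendsto_snd[OF l] by (simp_all add: o_def)
  have "(fst l $ i)\<^sup>2 + (snd l $ i)\<^sup>2 = 1" for i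
  proof (rule LIMSEQ_unique)
    show "(\<lambda>k. (a (r k) $ i)\<^sup>2 + (b (r k) $ i)\<^sup>2) \<longlonglongrightarrow> (fst l $ i)\<^sup>2 + (snd l $ i)\<^sup>2"
      by (intro tendsto_intros la lb)
  qed (simp add: ab)
  moreover have "apply_factors A' (fst l) (snd l) ?xs v = 0" for v
  proof (rule LIMSEQ_unique)
    show "(\<lambda>k. apply_factors (A (r k)) (a (r k)) (b (r k)) ?xs v)
        \<longlonglongrightarrow> apply_factors A' (fst l) (snd l) ?xs v"
      using LIMSEQ_subseq_LIMSEQ[OF lim r] la lb by (intro tendsto_apply_factors) (simp_all add: o_def)
  qed (simp add: zero)
  ultimately show ?thesis unfolding real_split_def by blast
qed

text \<open>
  Apply the annihilating factors one at a time to a nonzero vector of \<open>W\<close>. The last nonzero vector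
  before the product vanishes is an eigenvector, since a factor with \<open>a\<^sub>i = 0\<close> is invertible.
\<close>

lemma real_split_invariant_eigenvector:
  assumes "real_split A" "subspace W" "W \<noteq> {0}" and inv: "\<And>w. w \<in> W \<Longrightarrow> A *v w \<in> W"
  shows "\<exists>w\<in>W. w \<noteq> 0 \<and> (\<exists>\<mu>. A *v w = \<mu> *\<^sub>R w)"
proof -
  obtain a b where ab: "\<And>i. (a $ i)\<^sup>2 + (b $ i)\<^sup>2 = 1"
    and zero: "\<And>v. apply_factors A a b (sorted_list_of_set UNIV) v = 0"
    using assms(1) by (auto simp: real_split_def)
  obtain w where w: "w \<in> W" "w \<noteq> 0"
    using assms(2,3) subspace_0 by blast
  have mem: "apply_factors A a b xs w \<in> W" for xs
    by (induction xs) (auto simp: w inv assms(2) subspace_diff subspace_scale)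
  have "\<exists>u\<in>W. u \<noteq> 0 \<and> (\<exists>\<mu>. A *v u = \<mu> *\<^sub>R u)" if "apply_factors A a b xs w = 0" for xs
    using that
  proof (induction xs)
    case Nil
    then show ?case using w by simp
  next
    case (Cons i xs)
    let ?u = "apply_factors A a b xs w"
    show ?case
    proof (cases "?u = 0")
      case False
      have eq: "a $ i *\<^sub>R (A *v ?u) = b $ i *\<^sub>R ?u" using Cons.prems by simp
      have "a $ i \<noteq> 0"
      proof
        assume "a $ i = 0"
        with eq False have "b $ i = 0" by simp
        with \<open>a $ i = 0\<close> ab[of i] show False by simp
      qed
      have "A *v ?u = (1 / a $ i) *\<^sub>R (a $ i *\<^sub>R (A *v ?u))"
        using \<open>a $ i \<noteq> 0\<close> by simp
      also have "\<dots> = (1 / a $ i * b $ i) *\<^sub>R ?u"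
        unfolding eq by simp
      finally have "A *v ?u = (1 / a $ i * b $ i) *\<^sub>R ?u" .
      with False mem show ?thesis by blast
    qed (use Cons.IH in blast)
  qed
  with zero show ?thesis by blast
qed

section \<open>Consequences of irreducibility, and kernels of matrices\<close>

text \<open>
  The form in which irreducibility is used: a property that defines a subspace and holds on the orbit
  of a single nonzero vector holds everywhere.
\<close>

lemma irreducible_matricesD:
  assumes "irreducible_matrices S" "x \<noteq> 0" "subspace U" "\<And>A. A \<in> S \<Longrightarrow> A *v x \<in> U"
  shows "U = UNIV"
proof -
  have "span {A *v x | A. A \<in> S} \<subseteq> U"
    using assms(3,4) by (intro span_minimal) auto
  with assms(1,2) show ?thesis by (auto simp: irreducible_matrices_def)
qed

definition mker :: "real ^ 'n ^ 'm \<Rightarrow> (real ^ 'n) set" where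
  "mker A = {v. A *v v = 0}"

lemma mker_iff [simp]: "v \<in> mker A \<longleftrightarrow> A *v v = 0"
  by (simp add: mker_def)

lemma subspace_mker: "subspace (mker A)"
  by (auto simp: subspace_def matrix_vector_right_distrib matrix_vector_mult_scaleR)

lemma mker_mult_left: "mker B \<subseteq> mker (A ** B)"
  by (auto simp flip: matrix_vector_mul_assoc)

lemma norm_matrix_vector_mult:
  fixes A :: "real ^ 'n ^ 'm"
  shows "norm (A *v x) \<le> norm A * norm x"
proof -
  have "norm (A *v x) \<le> L2_set (\<lambda>i. norm (A $ i) * norm x) UNIV"
    unfolding norm_vec_def[of "A *v x"]
    by (intro L2_set_mono) (auto simp: matrix_vector_mul_component Cauchy_Schwarz_ineq2)
  also have "\<dots> = norm A * norm x"
    by (simp add: norm_vec_def[of A] L2_set_left_distrib)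
  finally show ?thesis .
qed

section \<open>Elements with maximal kernel in a closed homogeneous semigroup\<close>

text \<open>
  The features of the closed real cone over \<open>S\<close> that the construction of a rank-one element uses. The
  last assumption is the real-spectrum condition in the shape needed below.
\<close>

locale homogeneous_matrix_semigroup =
  fixes K :: "(real ^ 'n ^ 'n) set"
  assumes closed: "closed K"
    and mult: "A \<in> K \<Longrightarrow> B \<in> K \<Longrightarrow> A ** B \<in> K"
    and scale: "A \<in> K \<Longrightarrow> c *\<^sub>R A \<in> K"
    and irreducible: "irreducible_matrices K"
    and eigenvector: "A \<in> K \<Longrightarrow> subspace W \<Longrightarrow> W \<noteq> {0} \<Longrightarrow> (\<And>w. w \<in> W \<Longrightarrow> A *v w \<in> W) \<Longrightarrow>
      \<exists>w\<in>W. w \<noteq> 0 \<and> (\<exists>\<mu>. A *v w = \<mu> *\<^sub>R w)"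
begin

text \<open>
  Maximality of the kernel replaces minimality of the rank. It is the weaker requirement, and it
  passes directly to every nonzero element of \<open>K\<close> that vanishes on the same kernel.
\<close>

definition minimal :: "real ^ 'n ^ 'n \<Rightarrow> bool" where
  "minimal C \<longleftrightarrow> C \<in> K \<and> C \<noteq> 0 \<and> (\<forall>D\<in>K. D \<noteq> 0 \<longrightarrow> mker C \<subseteq> mker D \<longrightarrow> mker D = mker C)"

lemma minimal_transfer:
  assumes "minimal C" "D \<in> K" "D \<noteq> 0" "mker C \<subseteq> mker D"
  shows "minimal D" "mker D = mker C"
  using assms unfolding minimal_def by metis+

lemma minimal_mult:
  assumes "minimal C" "A \<in> K" "A ** C \<noteq> 0"
  shows "minimal (A ** C)" "mker (A ** C) = mker C"
  using minimal_transfer[OF assms(1) _ assms(3) mker_mult_left] mult[OF assms(2)] assms(1)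
  by (auto simp: minimal_def)

lemma ex_minimal: "\<exists>C. minimal C"
proof -
  have "\<exists>C\<in>K. C \<noteq> 0"
  proof (rule ccontr)
    assume "\<not> (\<exists>C\<in>K. C \<noteq> 0)"
    then have "{0 :: real ^ 'n} = UNIV"
      by (intro irreducible_matricesD[OF irreducible, of "axis undefined 1"]) auto
    moreover have "axis undefined (1::real) \<noteq> (0 :: real ^ 'n)" by simp
    ultimately show False by blast
  qed
  then have ne: "\<exists>C. C \<in> K \<and> C \<noteq> 0" by blast
  have "dim (mker C) < Suc DIM(real ^ 'n)" for C :: "real ^ 'n ^ 'n"
    unfolding less_Suc_eq_le by (rule dim_subset_UNIV)
  then have bound: "\<forall>C. C \<in> K \<and> C \<noteq> 0 \<longrightarrow> dim (mker C) < Suc DIM(real ^ 'n)"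
    by blast
  obtain C where C: "C \<in> K" "C \<noteq> 0" and max: "\<And>D. D \<in> K \<Longrightarrow> D \<noteq> 0 \<Longrightarrow> dim (mker D) \<le> dim (mker C)"
    using ex_has_greatest_nat[of "\<lambda>C. C \<in> K \<and> C \<noteq> 0" _ "\<lambda>C. dim (mker C)" "Suc DIM(real ^ 'n)"] ne bound
    by (metis (no_types, lifting))
  have "mker D = mker C" if "D \<in> K" "D \<noteq> 0" "mker C \<subseteq> mker D" for D
    using subspace_dim_equal[OF subspace_mker subspace_mker that(3)] max[OF that(1,2)] by simp
  with C show ?thesis unfolding minimal_def by blast
qed

text \<open>
  An element with maximal kernel may be nilpotent. Irreducibility gives an \<open>A\<close> with \<open>T A T \<noteq> 0\<close>, and
  \<open>A T\<close> has the same kernel as \<open>T\<close>. The range of \<open>A T\<close> is not contained in that kernel, so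
  \<open>(A T)\<^sup>2 \<noteq> 0\<close>.
\<close>

lemma ex_minimal_square_nonzero: "\<exists>B. minimal B \<and> B ** B \<noteq> 0"
proof -
  obtain T where T: "minimal T" using ex_minimal by blast
  then have TK: "T \<in> K" and "T \<noteq> 0" by (auto simp: minimal_def)
  then obtain y where y: "T *v y \<noteq> 0" by (metis matrix_eq matrix_vector_mult_0)
  have "\<exists>A\<in>K. T *v (A *v (T *v y)) \<noteq> 0"
  proof (rule ccontr)
    assume "\<not> ?thesis"
    then have "mker T = UNIV"
      using y by (intro irreducible_matricesD[OF irreducible _ subspace_mker, of "T *v y"]) auto
    then show False using y by auto
  qed
  then obtain A where A: "A \<in> K" and TAT: "T *v (A *v (T *v y)) \<noteq> 0" by blast
  have "A ** T \<noteq> 0"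
  proof
    assume "A ** T = 0"
    then have "A *v (T *v y) = 0" by (simp add: matrix_vector_mul_assoc)
    with TAT show False by simp
  qed
  note AT = minimal_mult[OF T A this]
  have "A *v (T *v y) \<notin> mker (A ** T)"
    unfolding AT(2) using TAT by simp
  then have "((A ** T) ** (A ** T)) *v y \<noteq> 0"
    by (simp flip: matrix_vector_mul_assoc)
  then show ?thesis using AT(1) by force
qed

text \<open>
  The power \<open>C\<^sup>m\<^sup>+\<^sup>1\<close>. The exponents start at one because \<open>K\<close> need not contain the identity, and so
  that every power vanishes on the kernel of \<open>C\<close>.
\<close>

definition mpow :: "real ^ 'n ^ 'n \<Rightarrow> nat \<Rightarrow> real ^ 'n ^ 'n" where
  "mpow C m = (((**) C) ^^ m) C"

lemma mpow_Suc: "mpow C (Suc m) *v v = C *v (mpow C m *v v)"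
  and mpow_0 [simp]: "mpow C 0 = C"
  by (simp_all add: mpow_def flip: matrix_vector_mul_assoc)

lemma mpow_mem: "C \<in> K \<Longrightarrow> mpow C m \<in> K"
  by (induction m) (simp_all add: mpow_def mult)

lemma mpow_eigenvector: "C *v x = \<mu> *\<^sub>R x \<Longrightarrow> mpow C m *v x = \<mu> ^ Suc m *\<^sub>R x"
  by (induction m) (simp_all add: mpow_Suc matrix_vector_mult_scaleR mult.commute)

text \<open>
  If the powers were unbounded, a limit \<open>D\<close> of normalised powers would be a nonzero element of \<open>K\<close>. It
  vanishes on the kernel of \<open>C\<close> and also on \<open>x\<close>, whose images under the powers of \<open>C\<close> stay bounded.
  So the kernel of \<open>D\<close> is strictly larger than the kernel of \<open>C\<close>.
\<close>

lemma minimal_powers_bounded: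
  assumes C: "minimal C" and x: "C *v x = x" "x \<noteq> 0"
  shows "bounded (range (mpow C))"
proof (rule ccontr)
  assume "\<not> ?thesis"
  then have "\<forall>k. \<exists>m. norm (mpow C m) > real k"
    unfolding bounded_iff by (metis (no_types) linorder_not_le rangeE)
  then obtain m where m: "\<And>k. norm (mpow C (m k)) > real k" by metis
  have pos: "norm (mpow C (m k)) > 0" for k
    using m[of k] by linarith
  define E where "E k = (1 / norm (mpow C (m k))) *\<^sub>R mpow C (m k)" for k
  have normE: "norm (E k) = 1" for k using pos[of k] by (simp add: E_def)
  then have "bounded (range E)" by (auto simp: bounded_iff)
  then obtain D r where r: "strict_mono r" and D: "(E \<circ> r) \<longlonglongrightarrow> D"
    by (metis bounded_imp_convergent_subsequence)
  have "D \<in> K"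
    using closed_sequentially[OF closed _ D] C by (auto simp: E_def minimal_def intro!: scale mpow_mem)
  moreover have "D \<noteq> 0"
  proof -
    have "(\<lambda>k. norm ((E \<circ> r) k)) \<longlonglongrightarrow> norm D" by (intro tendsto_norm D)
    then have "norm D = 1" using normE by (simp add: LIMSEQ_const_iff)
    then show ?thesis by auto
  qed
  moreover have "mker C \<subseteq> mker D"
  proof
    fix v assume "v \<in> mker C"
    then have "mpow C j *v v = 0" for j by (induction j) (simp_all add: mpow_Suc)
    then have "(E \<circ> r) k *v v = 0" for k by (simp add: E_def flip: scaleR_matrix_vector_assoc)
    moreover have "(\<lambda>k. (E \<circ> r) k *v v) \<longlonglongrightarrow> D *v v"
      by (intro tendsto_matrix_vector_mult D tendsto_const)
    ultimately show "v \<in> mker D" by (simp add: LIMSEQ_const_iff)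
  qed
  ultimately have ker: "mker D = mker C" using C by (auto simp: minimal_def)
  have "D *v x = 0"
  proof (rule LIMSEQ_unique)
    show "(\<lambda>k. (E \<circ> r) k *v x) \<longlonglongrightarrow> D *v x"
      by (intro tendsto_matrix_vector_mult D tendsto_const)
    have "norm ((E \<circ> r) k *v x) \<le> norm x * inverse (real k)" if "k > 0" for k
    proof -
      have "mpow C (m (r k)) *v x = x"
        using mpow_eigenvector[of C x 1] x(1) by simp
      then have "norm ((E \<circ> r) k *v x) = norm x / norm (mpow C (m (r k)))"
        by (simp add: E_def flip: scaleR_matrix_vector_assoc)
      also have "\<dots> \<le> norm x / real k"
        using m[of "r k"] seq_suble[OF r, of k] that by (intro divide_left_mono mult_pos_pos) auto
      finally show ?thesis by (simp add: divide_inverse)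
    qed
    then have "\<forall>\<^sub>F k in sequentially. norm ((E \<circ> r) k *v x) \<le> norm x * inverse (real k)"
      by (metis (mono_tags, lifting) eventually_sequentiallyI less_le_trans zero_less_one)
    moreover have "(\<lambda>k. norm x * inverse (real k)) \<longlonglongrightarrow> 0"
      using tendsto_mult[OF tendsto_const[of "norm x"] lim_inverse_n] by simp
    ultimately show "(\<lambda>k. (E \<circ> r) k *v x) \<longlonglongrightarrow> 0"
      by (rule Lim_null_comparison)
  qed
  then have "x \<in> mker C" using ker by auto
  with x show False by simp
qed

lemma minimal_eigenvalue_le_1:
  assumes C: "minimal C" and x: "C *v x = x" "x \<noteq> 0" and y: "C *v y = \<mu> *\<^sub>R y" "y \<noteq> 0"
  shows "\<bar>\<mu>\<bar> \<le> 1"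
proof (rule ccontr)
  assume "\<not> ?thesis"
  then have gt: "\<bar>\<mu>\<bar> > 1" by simp
  obtain M where M: "\<And>m. norm (mpow C m) \<le> M"
    using minimal_powers_bounded[OF C x] by (auto simp: bounded_iff)
  have "\<bar>\<mu>\<bar> ^ Suc m * norm y \<le> M * norm y" for m
  proof -
    have "\<bar>\<mu>\<bar> ^ Suc m * norm y = norm (mpow C m *v y)"
      using mpow_eigenvector[OF y(1), of m] by (simp add: power_abs abs_mult)
    also have "\<dots> \<le> norm (mpow C m) * norm y" by (rule norm_matrix_vector_mult)
    also have "\<dots> \<le> M * norm y" by (intro mult_right_mono M) auto
    finally show ?thesis .
  qed
  then have "\<bar>\<mu>\<bar> ^ Suc m \<le> M" for m
    using y(2) by simp
  moreover obtain m where "M < \<bar>\<mu>\<bar> ^ m" using real_arch_pow[OF gt] by blast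
  moreover have "\<bar>\<mu>\<bar> ^ m \<le> \<bar>\<mu>\<bar> ^ Suc m" using gt by (intro power_increasing) auto
  ultimately show False by (metis linorder_not_le order_trans)
qed

text \<open>
  The bound \<open>\<bar>\<mu>\<bar> \<le> 1\<close> holds for every pair of eigenvectors, so it may be applied a second time with
  the roles of \<open>x\<close> and \<open>y\<close> exchanged, to \<open>(1/\<mu>) C\<close>, which fixes \<open>y\<close> and scales \<open>x\<close> by \<open>1/\<mu>\<close>.
\<close>

lemma minimal_eigenvalue_abs_1:
  assumes C: "minimal C" and x: "C *v x = x" "x \<noteq> 0" and y: "C *v y = \<mu> *\<^sub>R y" "y \<noteq> 0" "\<mu> \<noteq> 0"
  shows "\<mu>\<^sup>2 = 1"
proof -
  have 1: "\<bar>\<mu>\<bar> \<le> 1" by (rule minimal_eigenvalue_le_1[OF C x y(1,2)])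
  have "minimal ((1/\<mu>) *\<^sub>R C)"
    using C y(3) by (intro minimal_transfer[OF C] scale) (auto simp: minimal_def simp flip: scaleR_matrix_vector_assoc)
  then have "\<bar>1/\<mu>\<bar> \<le> 1"
    using minimal_eigenvalue_le_1[of "(1/\<mu>) *\<^sub>R C" y x "1/\<mu>"] x y
    by (simp flip: scaleR_matrix_vector_assoc)
  with 1 y(3) have "\<bar>\<mu>\<bar> = 1" by (simp add: field_simps)
  then show ?thesis by (metis one_power2 power2_abs)
qed

text \<open>
  If \<open>C\<^sup>3 - C\<close> is nonzero, its range is invariant and so contains an eigenvector \<open>w = C\<^sup>3 u - C u\<close>. Its
  eigenvalue is \<open>\<plusminus>1\<close>, so \<open>C\<^sup>2 w = w\<close>, and the sequence \<open>C\<^sup>2\<^sup>m\<^sup>+\<^sup>1 u = C u + m w\<close> grows linearly. This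
  contradicts the boundedness of the powers of \<open>C\<close>.
\<close>

lemma minimal_cube:
  assumes C: "minimal C" and x: "C *v x = x" "x \<noteq> 0"
  shows "C *v (C *v (C *v v)) = C *v v"
proof (rule ccontr)
  assume neq: "C *v (C *v (C *v v)) \<noteq> C *v v"
  let ?F = "\<lambda>v. C *v (C *v (C *v v)) - C *v v"
  have CK: "C \<in> K" using C by (simp add: minimal_def)
  have "(C ** C) *v x = x" using x by (simp flip: matrix_vector_mul_assoc)
  then have "C ** C \<noteq> 0" using x(2) by auto
  from minimal_mult(2)[OF C CK this] have ker: "C *v u = 0" if "C *v (C *v u) = 0" for u
    using that by (metis mker_iff matrix_vector_mul_assoc)
  have lin: "linear ?F"
    by (intro linear_compose_sub linear_compose[unfolded o_def, of "(*v) C" "(*v) C"]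
        linear_compose[unfolded o_def, of "(*v) C" "\<lambda>v. C *v (C *v v)"]) auto
  have "\<exists>w\<in>range ?F. w \<noteq> 0 \<and> (\<exists>\<mu>. C *v w = \<mu> *\<^sub>R w)"
  proof (rule eigenvector[OF CK])
    show "subspace (range ?F)" by (rule linear_subspace_image[OF lin subspace_UNIV])
    have "?F v \<in> range ?F" by (rule rangeI)
    then show "range ?F \<noteq> {0}" using neq by (metis eq_iff_diff_eq_0 singletonD)
    show "C *v w \<in> range ?F" if "w \<in> range ?F" for w
      using that by (auto simp: matrix_vector_mult_diff_distrib intro!: image_eqI[where x = "C *v _"])
  qed
  then obtain u \<mu> where w: "?F u \<noteq> 0" "C *v ?F u = \<mu> *\<^sub>R ?F u" by blast
  define w where "w = ?F u"
  have Fu: "C *v (C *v (C *v u)) = C *v u + w" by (simp add: w_def)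
  have "\<mu> \<noteq> 0"
  proof
    assume "\<mu> = 0"
    with w(2) have "C *v (C *v (C *v (C *v u) - u)) = 0"
      by (simp add: matrix_vector_mult_diff_distrib)
    from ker[OF this] w(1) show False by (simp add: matrix_vector_mult_diff_distrib)
  qed
  then have "\<mu>\<^sup>2 = 1" by (intro minimal_eigenvalue_abs_1[OF C x w(2,1)])
  then have C2w: "C *v (C *v w) = w"
    using w(2) by (simp add: matrix_vector_mult_scaleR power2_eq_square flip: w_def)
  have growth: "mpow C (2 * m) *v u = C *v u + real m *\<^sub>R w" for m
  proof (induction m)
    case (Suc m)
    then show ?case
      by (simp add: mpow_Suc matrix_vector_right_distrib matrix_vector_mult_scaleR C2w Fu
          scaleR_add_left algebra_simps)
  qed simp
  obtain M where M: "\<And>m. norm (mpow C m) \<le> M"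
    using minimal_powers_bounded[OF C x] by (auto simp: bounded_iff)
  have le: "real m * norm w \<le> M * norm u + norm (C *v u)" for m
  proof -
    have "real m * norm w = norm (mpow C (2 * m) *v u - C *v u)" by (simp add: growth)
    also have "\<dots> \<le> norm (mpow C (2 * m) *v u) + norm (C *v u)" by (rule norm_triangle_ineq4)
    also have "norm (mpow C (2 * m) *v u) \<le> M * norm u"
      by (meson M norm_matrix_vector_mult mult_right_mono norm_ge_zero order_trans)
    finally show ?thesis by simp
  qed
  have "norm w > 0" using w(1) by (simp add: w_def)
  then obtain m where "M * norm u + norm (C *v u) < real m * norm w"
    using reals_Archimedean3 by blast
  with le[of m] show False by simp
qed

text \<open>
  An eigenvector in the range of \<open>B\<close> has a nonzero eigenvalue \<open>\<mu>\<close>, because \<open>B\<close> is injective on its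
  range. The matrix \<open>B / \<mu>\<close> then fixes a nonzero vector, and \<open>\<alpha> = \<mu>\<^sup>2\<close> works.
\<close>

lemma minimal_cube_scaled:
  assumes B: "minimal B" and BB: "B ** B \<noteq> 0"
  shows "\<exists>\<alpha>>0. \<forall>v. B *v (B *v (B *v v)) = \<alpha> *\<^sub>R (B *v v)"
proof -
  have BK: "B \<in> K" and "B \<noteq> 0" using B by (auto simp: minimal_def)
  have ker: "B *v u = 0" if "B *v (B *v u) = 0" for u
    using minimal_mult(2)[OF B BK BB] that by (metis mker_iff matrix_vector_mul_assoc)
  have "\<exists>w\<in>range ((*v) B). w \<noteq> 0 \<and> (\<exists>\<mu>. B *v w = \<mu> *\<^sub>R w)"
  proof (rule eigenvector[OF BK])
    show "subspace (range ((*v) B))" by (simp add: linear_subspace_image)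
    show "range ((*v) B) \<noteq> {0}"
      using \<open>B \<noteq> 0\<close> by (metis matrix_eq matrix_vector_mult_0 rangeI singletonD)
  qed auto
  then obtain u \<mu> where w: "B *v u \<noteq> 0" "B *v (B *v u) = \<mu> *\<^sub>R (B *v u)" by auto
  have \<mu>: "\<mu> \<noteq> 0" using w ker by auto
  have C: "minimal ((1/\<mu>) *\<^sub>R B)"
    using B \<mu> \<open>B \<noteq> 0\<close> by (intro minimal_transfer[OF B] scale BK) (auto simp flip: scaleR_matrix_vector_assoc)
  have "B *v (B *v (B *v v)) = \<mu>\<^sup>2 *\<^sub>R (B *v v)" for v
  proof -
    have "(1/\<mu>)^3 *\<^sub>R (B *v (B *v (B *v v))) = (1/\<mu>) *\<^sub>R (B *v v)"
      using minimal_cube[OF C _ w(1), of v] w(2) \<mu>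
      by (simp add: matrix_vector_mult_scaleR power3_eq_cube ac_simps flip: scaleR_matrix_vector_assoc)
    then have "\<mu>^3 *\<^sub>R ((1/\<mu>)^3 *\<^sub>R (B *v (B *v (B *v v)))) = \<mu>^3 *\<^sub>R ((1/\<mu>) *\<^sub>R (B *v v))"
      by simp
    then show ?thesis using \<mu> by (simp add: power3_eq_cube power2_eq_square)
  qed
  with \<mu> show ?thesis by (intro exI[of _ "\<mu>\<^sup>2"]) auto
qed

lemma ex_minimal_idempotent: "\<exists>e. minimal e \<and> e ** e = e"
proof -
  obtain B where B: "minimal B" "B ** B \<noteq> 0" using ex_minimal_square_nonzero by blast
  then obtain \<alpha> where \<alpha>: "\<alpha> > 0" and cube: "\<And>v. B *v (B *v (B *v v)) = \<alpha> *\<^sub>R (B *v v)"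
    using minimal_cube_scaled by blast
  have BK: "B \<in> K" using B by (simp add: minimal_def)
  let ?e = "(1/\<alpha>) *\<^sub>R (B ** B)"
  have "minimal ?e"
    using \<alpha> B(2) mker_mult_left[of B B]
    by (intro minimal_transfer[OF B(1)] scale mult BK) (auto simp flip: scaleR_matrix_vector_assoc)
  moreover have "?e ** ?e = ?e"
    using \<alpha> by (simp add: matrix_eq cube matrix_vector_mult_scaleR
        flip: scaleR_matrix_vector_assoc matrix_vector_mul_assoc)
  ultimately show ?thesis by blast
qed

section \<open>The corner of an idempotent with maximal kernel\<close>

text \<open>
  The kernel of \<open>a\<close> is that of \<open>e\<close>. Hence \<open>a\<close> can be cancelled on the left in \<open>a\<^sup>3 = \<alpha> a\<close>, at the
  price of a factor \<open>e\<close>. Positivity of \<open>\<alpha>\<close> is what the commutation argument depends on.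
\<close>

lemma corner_square:
  assumes e: "minimal e" "e ** e = e" and a: "a \<in> K" "a \<noteq> 0" "a ** e = a" "e ** a = a"
  shows "\<exists>\<alpha>>0. a ** a = \<alpha> *\<^sub>R e"
proof -
  have "mker e \<subseteq> mker a" using mker_mult_left[of e a] a(3) by simp
  note min = minimal_transfer[OF e(1) a(1,2) this]
  have ker: "e *v v = 0" if "a *v v = 0" for v using min(2) that by auto
  have "a ** a \<noteq> 0"
  proof
    assume "a ** a = 0"
    then have "a *v (a *v v) = 0" for v by (simp add: matrix_vector_mul_assoc)
    then have "e *v (a *v v) = 0" for v using ker by blast
    then have "a = 0" by (simp add: matrix_eq matrix_vector_mul_assoc a(4))
    with a(2) show False by simp
  qed
  from minimal_cube_scaled[OF min(1) this] obtain \<alpha>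
    where \<alpha>: "\<alpha> > 0" "\<And>v. a *v (a *v (a *v v)) = \<alpha> *\<^sub>R (a *v v)" by blast
  have "a *v (a *v v) = \<alpha> *\<^sub>R (e *v v)" for v
  proof -
    have "e *v (a *v (a *v v) - \<alpha> *\<^sub>R v) = 0"
      by (rule ker) (simp add: matrix_vector_mult_diff_distrib matrix_vector_mult_scaleR \<alpha>(2))
    then show ?thesis
      by (simp add: matrix_vector_mult_diff_distrib matrix_vector_mult_scaleR matrix_vector_mul_assoc
          matrix_mul_assoc a(4))
  qed
  then have "a ** a = \<alpha> *\<^sub>R e"
    by (simp add: matrix_eq flip: scaleR_matrix_vector_assoc matrix_vector_mul_assoc)
  with \<alpha>(1) show ?thesis by blast
qed

text \<open>
  If all squares were equal to \<open>e\<close>, this would be the fact that a group of exponent two is abelian.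
  Here the squares are positive multiples of \<open>e\<close>, so the two products are at first only positive
  multiples of each other, and it remains to see that the factor is one. This uses that \<open>(ab)\<^sup>2\<close> and
  \<open>(ba)\<^sup>2\<close> are the same multiple of \<open>e\<close>.
\<close>

lemma corner_commute:
  assumes e: "minimal e" "e ** e = e"
    and a: "a \<in> K" "a ** e = a" "e ** a = a" and b: "b \<in> K" "b ** e = b" "e ** b = b"
  shows "a ** b = b ** a"
proof (cases "a = 0 \<or> b = 0")
  case True
  then show ?thesis by auto
next
  case False
  then have "a \<noteq> 0" "b \<noteq> 0" by auto
  obtain \<alpha> where \<alpha>: "\<alpha> > 0" "a ** a = \<alpha> *\<^sub>R e" using corner_square[OF e] a \<open>a \<noteq> 0\<close> by blast
  obtain \<beta> where \<beta>: "\<beta> > 0" "b ** b = \<beta> *\<^sub>R e" using corner_square[OF e] b \<open>b \<noteq> 0\<close> by blast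
  have aab: "a ** (a ** b) = \<alpha> *\<^sub>R b"
    by (simp add: matrix_mul_assoc \<alpha>(2) b(3) flip: scalar_matrix_assoc)
  have bba: "b ** (b ** a) = \<beta> *\<^sub>R a"
    by (simp add: matrix_mul_assoc \<beta>(2) a(3) flip: scalar_matrix_assoc)
  have ab0: "a ** b \<noteq> 0" using aab \<alpha>(1) \<open>b \<noteq> 0\<close> by auto
  have ba0: "b ** a \<noteq> 0" using bba \<beta>(1) \<open>a \<noteq> 0\<close> by auto
  obtain \<gamma> where \<gamma>: "\<gamma> > 0" "(a ** b) ** (a ** b) = \<gamma> *\<^sub>R e"
    using corner_square[OF e mult[OF a(1) b(1)] ab0] a b
    by (metis matrix_mul_assoc)
  obtain \<delta> where \<delta>: "\<delta> > 0" "(b ** a) ** (b ** a) = \<delta> *\<^sub>R e"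
    using corner_square[OF e mult[OF b(1) a(1)] ba0] a b
    by (metis matrix_mul_assoc)
  have "\<gamma> *\<^sub>R b = b ** ((a ** b) ** (a ** b))"
    by (simp add: \<gamma>(2) matrix_scalar_ac b(2) flip: scalar_matrix_assoc)
  also have "\<dots> = ((b ** a) ** (b ** a)) ** b" by (simp add: matrix_mul_assoc)
  also have "\<dots> = \<delta> *\<^sub>R b" by (simp add: \<delta>(2) b(3) flip: scalar_matrix_assoc)
  finally have "\<gamma> = \<delta>" using \<open>b \<noteq> 0\<close> by simp
  have 1: "(\<alpha> * \<beta>) *\<^sub>R (b ** a) = \<gamma> *\<^sub>R (a ** b)"
  proof -
    have "\<gamma> *\<^sub>R (a ** b) = (a ** ((a ** b) ** (a ** b))) ** b"
      by (simp add: \<gamma>(2) matrix_scalar_ac a(2) flip: scalar_matrix_assoc)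
    also have "\<dots> = (a ** a) ** (b ** a) ** (b ** b)" by (simp add: matrix_mul_assoc)
    also have "\<dots> = (\<alpha> * \<beta>) *\<^sub>R (e ** (b ** a) ** e)"
      by (simp add: \<alpha>(2) \<beta>(2) matrix_scalar_ac flip: scalar_matrix_assoc)
    also have "e ** (b ** a) ** e = b ** a" by (metis matrix_mul_assoc a(2) b(3))
    finally show ?thesis by simp
  qed
  have 2: "(\<alpha> * \<beta>) *\<^sub>R (a ** b) = \<gamma> *\<^sub>R (b ** a)"
  proof -
    have "\<gamma> *\<^sub>R (b ** a) = (b ** ((b ** a) ** (b ** a))) ** a"
      by (simp add: \<delta>(2) \<open>\<gamma> = \<delta>\<close> matrix_scalar_ac b(2) flip: scalar_matrix_assoc)
    also have "\<dots> = (b ** b) ** (a ** b) ** (a ** a)" by (simp add: matrix_mul_assoc)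
    also have "\<dots> = (\<alpha> * \<beta>) *\<^sub>R (e ** (a ** b) ** e)"
      by (simp add: \<alpha>(2) \<beta>(2) matrix_scalar_ac flip: scalar_matrix_assoc)
    also have "e ** (a ** b) ** e = a ** b" by (metis matrix_mul_assoc b(2) a(3))
    finally show ?thesis by simp
  qed
  \<comment> \<open>The sum of the coefficients is positive, so the difference of the two relations can be divided by it.\<close>
  from 1 2 have "(\<alpha> * \<beta> + \<gamma>) *\<^sub>R (a ** b - b ** a) = 0"
    by (simp add: algebra_simps)
  moreover have "\<alpha> * \<beta> + \<gamma> > 0" using \<alpha> \<beta> \<gamma> by (simp add: add_pos_pos)
  ultimately show ?thesis by simp
qed

text \<open>
  Let \<open>a = e A e\<close> have an eigenvector \<open>w\<close> in the range of \<open>e\<close>, with eigenvalue \<open>\<mu>\<close>. Since \<open>a\<close>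
  commutes with every \<open>e B e\<close>, all the vectors \<open>e B w\<close> lie in the same eigenspace, and by
  irreducibility they span the range of \<open>e\<close>.
\<close>

lemma corner_scalar:
  assumes e: "minimal e" "e ** e = e" and A: "A \<in> K"
  shows "\<exists>\<mu>. \<forall>v. e *v (A *v (e *v v)) = \<mu> *\<^sub>R (e *v v)"
proof -
  have eK: "e \<in> K" "e \<noteq> 0" using e(1) by (auto simp: minimal_def)
  define a where "a = e ** A ** e"
  have corner: "e ** X ** e \<in> K" "(e ** X ** e) ** e = e ** X ** e" "e ** (e ** X ** e) = e ** X ** e"
    if "X \<in> K" for X
    using that eK e(2) mult by (auto, (metis matrix_mul_assoc)+)
  have ee: "e *v (e *v v) = e *v v" for v by (simp add: matrix_vector_mul_assoc e(2))
  have av: "a *v v = e *v (A *v (e *v v))" for v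
    by (simp add: a_def flip: matrix_vector_mul_assoc)
  have "\<exists>w\<in>range ((*v) e). w \<noteq> 0 \<and> (\<exists>\<mu>. a *v w = \<mu> *\<^sub>R w)"
  proof (rule eigenvector)
    show "a \<in> K" using corner(1)[OF A] by (simp add: a_def)
    show "subspace (range ((*v) e))" by (simp add: linear_subspace_image)
    show "range ((*v) e) \<noteq> {0}"
      using \<open>e \<noteq> 0\<close> by (metis matrix_eq matrix_vector_mult_0 rangeI singletonD)
  qed (auto simp: av)
  then obtain w \<mu> where w: "e *v w = w" "w \<noteq> 0" "a *v w = \<mu> *\<^sub>R w" using ee by auto
  have lin: "linear (\<lambda>y. a *v (e *v y) - \<mu> *\<^sub>R (e *v y))"
    by (intro linear_compose_sub linear_compose_scale_right
        linear_compose[unfolded o_def, of "(*v) e" "(*v) a"]) auto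
  have "{y. a *v (e *v y) - \<mu> *\<^sub>R (e *v y) = 0} = UNIV"
  proof (rule irreducible_matricesD[OF irreducible w(2)])
    show "subspace {y. a *v (e *v y) - \<mu> *\<^sub>R (e *v y) = 0}"
      by (rule linear_subspace_kernel[OF lin])
    fix B assume B: "B \<in> K"
    have "a ** (e ** B ** e) = (e ** B ** e) ** a"
      using corner_commute[OF e] corner[OF A] corner[OF B] unfolding a_def by blast
    then have "a *v ((e ** B ** e) *v w) = (e ** B ** e) *v (a *v w)"
      by (simp add: matrix_vector_mul_assoc)
    then have "a *v (e *v (B *v w)) = \<mu> *\<^sub>R (e *v (B *v w))"
      by (simp add: w matrix_vector_mult_scaleR flip: matrix_vector_mul_assoc)
    then show "B *v w \<in> {y. a *v (e *v y) - \<mu> *\<^sub>R (e *v y) = 0}" by simp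
  qed
  then have "a *v (e *v y) = \<mu> *\<^sub>R (e *v y)" for y by auto
  then show ?thesis by (auto simp: av ee)
qed

text \<open>
  Every \<open>e A e\<close> maps \<open>x = e y\<close> to a multiple of \<open>x\<close>, whereas the vectors \<open>A x\<close> span the whole space.
  Applying \<open>e\<close> shows that the range of \<open>e\<close> is the line through \<open>x\<close>.
\<close>

lemma ex_rank_one: "\<exists>e\<in>K. \<exists>x. x \<noteq> 0 \<and> e *v x = x \<and> range ((*v) e) = span {x}"
proof -
  obtain e where e: "minimal e" "e ** e = e" using ex_minimal_idempotent by blast
  have eK: "e \<in> K" "e \<noteq> 0" using e(1) by (auto simp: minimal_def)
  have ee: "e *v (e *v v) = e *v v" for v by (simp add: matrix_vector_mul_assoc e(2))
  obtain y where y: "e *v y \<noteq> 0" using \<open>e \<noteq> 0\<close> by (metis matrix_eq matrix_vector_mult_0)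
  let ?x = "e *v y"
  have "{v. e *v v \<in> span {?x}} = UNIV"
  proof (rule irreducible_matricesD[OF irreducible y])
    show "subspace {v. e *v v \<in> span {?x}}"
      using linear_subspace_vimage[of "(*v) e" "span {?x}"] by (simp add: vimage_def)
    show "A *v ?x \<in> {v. e *v v \<in> span {?x}}" if "A \<in> K" for A
    proof -
      obtain \<mu> where "e *v (A *v ?x) = \<mu> *\<^sub>R ?x" using corner_scalar[OF e \<open>A \<in> K\<close>] by blast
      then show ?thesis by (simp add: span_base span_scale)
    qed
  qed
  moreover have "span {?x} \<subseteq> range ((*v) e)"
    by (intro span_minimal) (auto simp: linear_subspace_image)
  ultimately have "range ((*v) e) = span {?x}" by auto
  then show ?thesis using eK y ee by blast
qed

end

section \<open>Irreducible semigroups whose span contains a matrix of rank one\<close>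

definition outer :: "real ^ 'm \<Rightarrow> real ^ 'n \<Rightarrow> real ^ 'n ^ 'm" where
  "outer x w = (\<chi> i j. x $ i * w $ j)"

lemma outer_mult_vec: "outer x w *v v = (w \<bullet> v) *\<^sub>R x"
  by (simp add: outer_def vec_eq_iff matrix_vector_mult_def inner_vec_def sum_distrib_left ac_simps)

lemma rank_one_eq_outer:
  fixes e :: "real ^ 'n ^ 'm"
  assumes "range ((*v) e) \<subseteq> span {x}"
  shows "\<exists>w. e = outer x w"
proof -
  have "\<exists>c. e *v axis j 1 = c *\<^sub>R x" for j
    using assms by (auto simp: span_singleton)
  then obtain w where w: "\<And>j. e *v axis j 1 = w j *\<^sub>R x" by metis
  have "e $ i $ j = x $ i * w j" for i j
  proof -
    have "e $ i $ j = (e *v axis j 1) $ i" by (simp add: matrix_vector_mul_component inner_axis)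
    then show ?thesis by (simp add: w)
  qed
  then show ?thesis by (intro exI[of _ "\<chi> j. w j"]) (simp add: outer_def vec_eq_iff)
qed

lemma linear_outer_left: "linear (\<lambda>x. outer x w)"
  and linear_outer_right: "linear (outer x)"
  by (rule linearI; simp add: outer_def vec_eq_iff algebra_simps)+

lemma matrix_mult_outer: "A ** outer x w = outer (A *v x) w"
  by (simp add: matrix_eq outer_mult_vec matrix_vector_mult_scaleR flip: matrix_vector_mul_assoc)

lemma outer_mult_matrix: "outer x w ** A = outer x (w v* A)"
  by (simp add: matrix_eq outer_mult_vec dot_lmul_matrix flip: matrix_vector_mul_assoc)

lemma matrix_sum_outer: "A = (\<Sum>i\<in>UNIV. outer (axis i 1) (A $ i))"
  by (simp add: vec_eq_iff outer_def axis_def if_distrib[of "\<lambda>c. c * _"] cong: if_cong)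

text \<open>
  Multiplying \<open>outer x w\<close> by \<open>S\<close> from the left moves \<open>x\<close> through a spanning set. Multiplying from the
  right moves \<open>w\<close> through the vectors \<open>w v* A\<close>; a nonzero vector \<open>u\<close> orthogonal to all of them would
  have its whole orbit in the hyperplane orthogonal to \<open>w\<close>, so these span as well.
\<close>

lemma irreducible_rank_one_span:
  assumes S: "matrix_semigroup S" "irreducible_matrices S"
    and e: "e \<in> span S" "e \<noteq> 0" "range ((*v) e) \<subseteq> span {x}"
  shows "span S = UNIV"
proof -
  obtain w where w: "e = outer x w" using rank_one_eq_outer[OF e(3)] by blast
  have x0: "x \<noteq> 0" and w0: "w \<noteq> 0"
    using e(2) by (auto simp: w outer_def vec_eq_iff)
  have left: "outer y w \<in> span S" for y
  proof -
    have "{y. outer y w \<in> span S} = UNIV"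
    proof (rule irreducible_matricesD[OF S(2) x0])
      show "subspace {y. outer y w \<in> span S}"
        using linear_subspace_vimage[OF linear_outer_left subspace_span] by (simp add: vimage_def)
      show "A *v x \<in> {y. outer y w \<in> span S}" if "A \<in> S" for A
        using span_matrix_mult_closed[OF S(1) span_base[OF that] e(1)]
        by (simp add: w matrix_mult_outer)
    qed
    then show ?thesis by blast
  qed
  have full: "span {w v* A | A. A \<in> S} = UNIV"
  proof (rule ccontr)
    assume "\<not> ?thesis"
    then obtain u where u: "u \<noteq> 0" and orth: "\<And>v. v \<in> span {w v* A | A. A \<in> S} \<Longrightarrow> u \<bullet> v = 0"
      using span_not_UNIV_orthogonal by blast
    have "{v. w \<bullet> v = 0} = UNIV"
    proof (rule irreducible_matricesD[OF S(2) u])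
      show "subspace {v. w \<bullet> v = 0}" by (rule subspace_hyperplane)
      fix A assume "A \<in> S"
      then have "(w v* A) \<bullet> u = 0"
        by (subst inner_commute) (intro orth span_base, blast)
      then show "A *v u \<in> {v. w \<bullet> v = 0}" by (simp add: dot_lmul_matrix)
    qed
    then have "w \<bullet> w = 0" by blast
    with w0 show False by simp
  qed
  have all: "outer y z \<in> span S" for y z
  proof -
    have sub: "subspace {z. outer y z \<in> span S}"
      using linear_subspace_vimage[OF linear_outer_right subspace_span] by (simp add: vimage_def)
    have "outer y (w v* A) \<in> span S" if "A \<in> S" for A
      using span_matrix_mult_closed[OF S(1) left[of y] span_base[OF that]]
      by (simp add: outer_mult_matrix)
    then have "span {w v* A | A. A \<in> S} \<subseteq> {z. outer y z \<in> span S}"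
      by (intro span_minimal[OF _ sub]) auto
    with full show ?thesis by auto
  qed
  have "A \<in> span S" for A
    by (subst matrix_sum_outer) (intro span_sum all)
  then show ?thesis by blast
qed

section \<open>The closed cone over a semigroup of triangularizable matrices\<close>

lemma homogeneous_matrix_semigroup_closure:
  fixes S :: "(real ^ 'n::{finite, linorder} ^ 'n::{finite, linorder}) set"
  assumes "matrix_semigroup S" "irreducible_matrices S" "\<forall>A\<in>S. triangularizable A"
  shows "homogeneous_matrix_semigroup (closure {c *\<^sub>R A | c A. A \<in> S})"
proof
  let ?R = "{c *\<^sub>R A | c A. A \<in> S}"
  show "closed (closure ?R)" by simp
  show "A ** B \<in> closure ?R" if AB: "A \<in> closure ?R" "B \<in> closure ?R" for A B
  proof -
    obtain f g where f: "\<And>k. f k \<in> ?R" "f \<longlonglongrightarrow> A" and g: "\<And>k. g k \<in> ?R" "g \<longlonglongrightarrow> B"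
      using AB unfolding closure_sequential by blast
    have "f k ** g k \<in> ?R" for k
    proof -
      obtain c A' d B' where eq: "f k = c *\<^sub>R A'" "g k = d *\<^sub>R B'" and mem: "A' \<in> S" "B' \<in> S"
        using f(1)[of k] g(1)[of k] by blast
      have "f k ** g k = (c * d) *\<^sub>R (A' ** B')"
        by (simp add: eq matrix_scalar_ac flip: scalar_matrix_assoc)
      moreover have "A' ** B' \<in> S" using mem assms(1) by (simp add: matrix_semigroup_def)
      ultimately show ?thesis by blast
    qed
    with tendsto_matrix_matrix_mult[OF f(2) g(2)] show ?thesis
      unfolding closure_sequential by (intro exI[of _ "\<lambda>k. f k ** g k"] conjI allI)
  qed
  show "c *\<^sub>R A \<in> closure ?R" if A: "A \<in> closure ?R" for A c
  proof -
    obtain f where f: "\<And>k. f k \<in> ?R" "f \<longlonglongrightarrow> A"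
      using A unfolding closure_sequential by blast
    have "c *\<^sub>R f k \<in> ?R" for k
      using f(1)[of k] by force
    with tendsto_scaleR[OF tendsto_const f(2)] show ?thesis
      unfolding closure_sequential by (intro exI[of _ "\<lambda>k. c *\<^sub>R f k"] conjI allI)
  qed
  have "A \<in> ?R" if "A \<in> S" for A
    using that by (intro CollectI exI[of _ 1] exI[of _ A]) simp
  then have "S \<subseteq> closure ?R"
    using closure_subset[of ?R] by blast
  show "irreducible_matrices (closure ?R)"
    unfolding irreducible_matrices_def
  proof (intro allI impI)
    fix x :: "(real, 'n) vec" assume "x \<noteq> 0"
    then have "span {A *v x | A. A \<in> S} = UNIV"
      using assms(2) by (simp add: irreducible_matrices_def)
    moreover have "span {A *v x | A. A \<in> S} \<subseteq> span {A *v x | A. A \<in> closure ?R}"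
      using \<open>S \<subseteq> closure ?R\<close> by (intro span_mono) blast
    ultimately show "span {A *v x | A. A \<in> closure ?R} = UNIV" by blast
  qed
  fix A W
  assume A: "A \<in> closure ?R" and W: "subspace W" "W \<noteq> {0}" "\<And>w. w \<in> W \<Longrightarrow> A *v w \<in> W"
  obtain f where f: "\<And>k. f k \<in> ?R" "f \<longlonglongrightarrow> A"
    using A unfolding closure_sequential by blast
  have "real_split (f k)" for k
  proof -
    obtain c B where "f k = c *\<^sub>R B" "B \<in> S" using f(1)[of k] by blast
    then show ?thesis using assms(3) real_split_scaleR_triangularizable[of B c] by simp
  qed
  then have "real_split A" using f(2) by (rule real_split_limit)
  then show "\<exists>w\<in>W. w \<noteq> 0 \<and> (\<exists>\<mu>. A *v w = \<mu> *\<^sub>R w)"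
    using W by (rule real_split_invariant_eigenvector)
qed

theorem theorem2p3:
  fixes S :: "(real ^ 'n::{finite, linorder} ^ 'n::{finite, linorder}) set"
  assumes "matrix_semigroup S"
    and "irreducible_matrices S"
    and "\<forall>A\<in>S. triangularizable A"
  shows "matrix_Alg S = UNIV"
proof -
  let ?K = "closure {c *\<^sub>R A | c A. A \<in> S}"
  interpret homogeneous_matrix_semigroup ?K
    by (rule homogeneous_matrix_semigroup_closure[OF assms])
  obtain e x where e: "e \<in> ?K" "x \<noteq> 0" "e *v x = x" "range ((*v) e) = span {x}"
    using ex_rank_one by blast
  have "?K \<subseteq> span S"
    by (intro closure_minimal closed_subspace subspace_span) (auto intro: span_scale span_base)
  with e have "e \<in> span S" "e \<noteq> 0" by auto
  with e(4) have "span S = UNIV"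
    by (intro irreducible_rank_one_span[OF assms(1,2), of e x]) auto
  then show ?thesis by (simp add: matrix_Alg_eq_span[OF assms(1)])
qed

end
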